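(* Every quandle homomorphism $f\colon (Q,q)\to(Q',q')$ of pointed quandles induces a group homomorphism $f_*\colon \pi_1(Q,q)\to\pi_1(Q',q')$ (the restriction of $\mathrm{Adj}(f)$). In this way one obtains a functor $\pi_1$ from the category of pointed quandles to the category of groups.
   Context: A quandle is a set $Q$ with two binary operations $*,\bar{*}$ such that for all $a,b,c\in Q$: $a*a=a$; $(a*b)\bar{*}b=a=(a\bar{*}b)*b$; $(a*b)*c=(a*c)*(b*c)$. A quandle homomorphism is a map preserving $*$ (hence $\bar{*}$). A pointed quandle $(Q,q)$ is a quandle with a base point $q\in Q$; homomorphisms of pointed quandles are quandle homomorphisms preserving base points. The adjoint group $\mathrm{Adj}(Q)$ is the group generated by symbols $\mathrm{adj}(a)$, $a\in Q$, subject to the relations $\mathrm{adj}(a*b)=\mathrm{adj}(b)^{-1}\mathrm{adj}(a)\,\mathrm{adj}(b)$ for $a,b\in Q$. It acts on $Q$ from the right by quandle automorphisms, written $(a,g)\mapsto a^g$, with $a^{\mathrm{adj}(b)}=a*b$. A quandle homomorphism $f\colon Q\to Q'$ induces the group homomorphism $\mathrm{Adj}(f)\colon\mathrm{Adj}(Q)\to\mathrm{Adj}(Q')$, $\mathrm{adj}(a)\mapsto\mathrm{adj}(f(a))$. Let $\varepsilon\colon\mathrm{Adj}(Q)\to\mathbb{Z}$ be the homomorphism with $\varepsilon(\mathrm{adj}(a))=1$ for all $a\in Q$, and $\mathrm{Adj}(Q)^\circ=\ker\varepsilon$. The fundamental group of $Q$ based at $q$ is $\pi_1(Q,q)=\{g\in\mathrm{Adj}(Q)^\circ\mid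 q^g=q\}$. *)

theory Defs
  imports "HOL-Algebra.Elementary_Groups" "HOL-Library.FuncSet"
begin

section \<open>Quandles and their homomorphisms\<close>

record 'a quandle = "'a partial_object" +
  qop :: "['a, 'a] \<Rightarrow> 'a" (infixl "\<star>\<index>" 70)
  qbar :: "['a, 'a] \<Rightarrow> 'a" (infixl "\<diamondop>\<index>" 70)

record 'a pointed_quandle = "'a quandle" +
  base :: 'a

locale quandle =
  fixes Q (structure)
  assumes qop_closed [intro, simp]:
      "\<lbrakk>a \<in> carrier Q; b \<in> carrier Q\<rbrakk> \<Longrightarrow> a \<star> b \<in> carrier Q"
    and qbar_closed [intro, simp]:
      "\<lbrakk>a \<in> carrier Q; b \<in> carrier Q\<rbrakk> \<Longrightarrow> a \<diamondop> b \<in> carrier Q"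
    and qop_idem: "a \<in> carrier Q \<Longrightarrow> a \<star> a = a"
    and qop_qbar: "\<lbrakk>a \<in> carrier Q; b \<in> carrier Q\<rbrakk> \<Longrightarrow> (a \<star> b) \<diamondop> b = a"
    and qbar_qop: "\<lbrakk>a \<in> carrier Q; b \<in> carrier Q\<rbrakk> \<Longrightarrow> (a \<diamondop> b) \<star> b = a"
    and qop_distrib: "\<lbrakk>a \<in> carrier Q; b \<in> carrier Q; c \<in> carrier Q\<rbrakk>
      \<Longrightarrow> (a \<star> b) \<star> c = (a \<star> c) \<star> (b \<star> c)"

locale pointed_quandle = quandle Q for Q (structure) +
  assumes base_closed [intro, simp]: "base Q \<in> carrier Q"

definition quandle_hom :: "('a, 'm) quandle_scheme \<Rightarrow> ('b, 'n) quandle_scheme \<Rightarrow> ('a \<Rightarrow> 'b) set"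
  where "quandle_hom Q Q' = {f \<in> carrier Q \<rightarrow> carrier Q'.
    \<forall>a\<in>carrier Q. \<forall>b\<in>carrier Q. f (a \<star>\<^bsub>Q\<^esub> b) = f a \<star>\<^bsub>Q'\<^esub> f b}"

definition pointed_quandle_hom ::
    "'a pointed_quandle \<Rightarrow> 'b pointed_quandle \<Rightarrow> ('a \<Rightarrow> 'b) set"
  where "pointed_quandle_hom Q Q' = {f \<in> quandle_hom Q Q'. f (base Q) = base Q'}"


section \<open>Groups given by generators and relations\<close>

text \<open>
  A letter \<open>(x, True)\<close> stands for the generator \<open>x\<close> and \<open>(x, False)\<close> for its inverse.
  A relation is a pair of words that are to become equal.
\<close>

type_synonym 'a group_word = "('a \<times> bool) list"

definition words :: "'a set \<Rightarrow> 'a group_word set"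
  where "words S = lists (S \<times> UNIV)"

inductive word_eq :: "'a set \<Rightarrow> ('a group_word \<times> 'a group_word) set \<Rightarrow>
    'a group_word \<Rightarrow> 'a group_word \<Rightarrow> bool"
  for S R where
    refl: "w \<in> words S \<Longrightarrow> word_eq S R w w"
  | sym: "word_eq S R u v \<Longrightarrow> word_eq S R v u"
  | trans: "\<lbrakk>word_eq S R u v; word_eq S R v w\<rbrakk> \<Longrightarrow> word_eq S R u w"
  | append: "\<lbrakk>word_eq S R u u'; word_eq S R v v'\<rbrakk> \<Longrightarrow> word_eq S R (u @ v) (u' @ v')"
  | cancel: "x \<in> S \<Longrightarrow> word_eq S R [(x, e), (x, \<not> e)] []"
  | rel: "\<lbrakk>(u, v) \<in> R; u \<in> words S; v \<in> words S\<rbrakk> \<Longrightarrow> word_eq S R u v"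

definition word_class :: "'a set \<Rightarrow> ('a group_word \<times> 'a group_word) set \<Rightarrow>
    'a group_word \<Rightarrow> 'a group_word set"
  where "word_class S R w = {v. word_eq S R w v}"

definition presented_group :: "'a set \<Rightarrow> ('a group_word \<times> 'a group_word) set \<Rightarrow>
    'a group_word set monoid"
  where "presented_group S R =
    \<lparr>carrier = word_class S R ` words S,
     monoid.mult = (\<lambda>X Y. \<Union>u\<in>X. \<Union>v\<in>Y. word_class S R (u @ v)),
     one = word_class S R []\<rparr>"

primrec word_eval :: "('g, 'm) monoid_scheme \<Rightarrow> ('a \<Rightarrow> 'g) \<Rightarrow> 'a group_word \<Rightarrow> 'g"
  where
    "word_eval G h [] = \<one>\<^bsub>G\<^esub>"
  | "word_eval G h (x # w) =
      (if snd x then h (fst x) else inv\<^bsub>G\<^esub> (h (fst x))) \<otimes>\<^bsub>G\<^esub> word_eval G h w"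

text \<open>
  The homomorphism to \<open>G\<close> with prescribed values \<open>h\<close> on the generators; all words in the
  class \<open>X\<close> have the same value as soon as \<open>h\<close> respects the relations.
\<close>

definition presented_lift :: "('g, 'm) monoid_scheme \<Rightarrow> ('a \<Rightarrow> 'g) \<Rightarrow> 'a group_word set \<Rightarrow> 'g"
  where "presented_lift G h X = the_elem (word_eval G h ` X)"

lemma words_simps [simp]:
  "[] \<in> words S"
  "l # w \<in> words S \<longleftrightarrow> fst l \<in> S \<and> w \<in> words S"
  "u @ v \<in> words S \<longleftrightarrow> u \<in> words S \<and> v \<in> words S"
  by (cases l; auto simp: words_def)+

lemma words_inverse: "w \<in> words S \<Longrightarrow> rev (map (apsnd Not) w) \<in> words S"
  by (induction w) auto

lemma word_eq_words: "word_eq S R u v \<Longrightarrow> u \<in> words S \<and> v \<in> words S"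
  by (induction rule: word_eq.induct) auto

lemma word_class_eq_iff:
  assumes "u \<in> words S"
  shows "word_class S R u = word_class S R v \<longleftrightarrow> word_eq S R u v"
proof
  assume "word_class S R u = word_class S R v"
  then have "u \<in> word_class S R v"
    using word_eq.refl [OF assms, of R] by (auto simp: word_class_def)
  then show "word_eq S R u v"
    by (auto simp: word_class_def intro: word_eq.sym)
next
  assume "word_eq S R u v"
  then show "word_class S R u = word_class S R v"
    by (auto simp: word_class_def intro: word_eq.sym word_eq.trans)
qed

lemma word_class_eqI: "word_eq S R u v \<Longrightarrow> word_class S R u = word_class S R v"
  using word_class_eq_iff word_eq_words by metis

lemma presented_mult:
  assumes "u \<in> words S" "v \<in> words S"
  shows "word_class S R u \<otimes>\<^bsub>presented_group S R\<^esub> word_class S R v = word_class S R (u @ v)"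
proof -
  have "word_class S R (u' @ v') = word_class S R (u @ v)"
    if "u' \<in> word_class S R u" "v' \<in> word_class S R v" for u' v'
    using that
    by (intro word_class_eqI [symmetric] word_eq.append) (auto simp: word_class_def)
  moreover have "u \<in> word_class S R u" "v \<in> word_class S R v"
    using assms by (auto simp: word_class_def intro: word_eq.refl)
  ultimately have "(\<Union>u'\<in>word_class S R u. \<Union>v'\<in>word_class S R v. word_class S R (u' @ v')) =
      word_class S R (u @ v)"
    by blast
  then show ?thesis
    by (simp add: presented_group_def)
qed

lemma word_eq_inverse:
  assumes "w \<in> words S"
  shows "word_eq S R (rev (map (apsnd Not) w) @ w) []"
  using assms
proof (induction w)
  case Nil
  show ?case by (auto intro: word_eq.refl)
next
  case (Cons l w)
  obtain x e where l: "l = (x, e)" by force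
  define v where "v = rev (map (apsnd Not) w)"
  have w: "w \<in> words S" "x \<in> S" using Cons l by auto
  then have v: "v \<in> words S" unfolding v_def by (simp add: words_inverse)
  have "word_eq S R ([(x, \<not> e), (x, \<not> \<not> e)] @ w) ([] @ w)"
    by (intro word_eq.append word_eq.cancel word_eq.refl w)
  then have "word_eq S R (v @ [(x, \<not> e), (x, e)] @ w) (v @ w)"
    using word_eq.append [OF word_eq.refl [OF v]] by fastforce
  moreover have "word_eq S R (v @ w) []"
    using Cons.IH w by (simp add: v_def)
  ultimately show ?case
    by (auto simp: l v_def intro: word_eq.trans)
qed

lemma group_presented_group: "group (presented_group S R)"
proof (rule groupI)
  show "\<one>\<^bsub>presented_group S R\<^esub> \<in> carrier (presented_group S R)"
    by (auto simp: presented_group_def)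
next
  fix X assume "X \<in> carrier (presented_group S R)"
  then obtain w where w: "w \<in> words S" "X = word_class S R w"
    by (auto simp: presented_group_def)
  show "\<one>\<^bsub>presented_group S R\<^esub> \<otimes>\<^bsub>presented_group S R\<^esub> X = X"
    using presented_mult [of "[]" S w R] w by (simp add: presented_group_def)
  let ?v = "rev (map (apsnd Not) w)"
  have v: "?v \<in> words S" using w(1) by (rule words_inverse)
  have "word_class S R (?v @ w) = word_class S R []"
    by (intro word_class_eqI word_eq_inverse w)
  then have "word_class S R ?v \<otimes>\<^bsub>presented_group S R\<^esub> X = \<one>\<^bsub>presented_group S R\<^esub>"
    using presented_mult [OF v w(1)] w(2) by (simp add: presented_group_def)
  moreover have "word_class S R ?v \<in> carrier (presented_group S R)"
    using v by (simp add: presented_group_def)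
  ultimately show "\<exists>Y\<in>carrier (presented_group S R).
      Y \<otimes>\<^bsub>presented_group S R\<^esub> X = \<one>\<^bsub>presented_group S R\<^esub>" by blast
next
  fix X Y assume "X \<in> carrier (presented_group S R)" "Y \<in> carrier (presented_group S R)"
  then obtain u v where *: "u \<in> words S" "X = word_class S R u"
      "v \<in> words S" "Y = word_class S R v"
    by (auto simp: presented_group_def)
  show "X \<otimes>\<^bsub>presented_group S R\<^esub> Y \<in> carrier (presented_group S R)"
    using * by (simp add: presented_mult) (simp add: presented_group_def)
  fix Z assume "Z \<in> carrier (presented_group S R)"
  then obtain w where "w \<in> words S" "Z = word_class S R w"
    by (auto simp: presented_group_def)
  with * show "X \<otimes>\<^bsub>presented_group S R\<^esub> Y \<otimes>\<^bsub>presented_group S R\<^esub> Z =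
      X \<otimes>\<^bsub>presented_group S R\<^esub> (Y \<otimes>\<^bsub>presented_group S R\<^esub> Z)"
    by (simp add: presented_mult)
qed

locale presentation_map = group G for G (structure) and S R and h :: "'a \<Rightarrow> 'b" +
  assumes h_closed: "x \<in> S \<Longrightarrow> h x \<in> carrier G"
    and h_rel: "\<lbrakk>(u, v) \<in> R; u \<in> words S; v \<in> words S\<rbrakk> \<Longrightarrow> word_eval G h u = word_eval G h v"
begin

lemma word_eval_closed: "w \<in> words S \<Longrightarrow> word_eval G h w \<in> carrier G"
  by (induction w) (simp_all add: h_closed)

lemma word_eval_append:
  "\<lbrakk>u \<in> words S; v \<in> words S\<rbrakk> \<Longrightarrow> word_eval G h (u @ v) = word_eval G h u \<otimes> word_eval G h v"
proof (induction u)
  case (Cons l u)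
  define g where "g = (if snd l then h (fst l) else inv h (fst l))"
  have "g \<in> carrier G" using Cons.prems by (simp add: g_def h_closed)
  then show ?case
    using Cons by (simp add: g_def [symmetric] m_assoc word_eval_closed)
qed (simp add: word_eval_closed)

lemma word_eval_word_eq: "word_eq S R u v \<Longrightarrow> word_eval G h u = word_eval G h v"
proof (induction rule: word_eq.induct)
  case (append u u' v v')
  then show ?case
    using word_eq_words [OF append.hyps(1)] word_eq_words [OF append.hyps(2)]
    by (simp add: word_eval_append)
next
  case (rel u v)
  then show ?case by (rule h_rel)
qed (simp_all add: h_closed)

lemma presented_lift_class:
  assumes "w \<in> words S"
  shows "presented_lift G h (word_class S R w) = word_eval G h w"
proof -
  have "w \<in> word_class S R w"
    using assms by (simp add: word_class_def word_eq.refl)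
  moreover have "word_eval G h v = word_eval G h w" if "v \<in> word_class S R w" for v
    using that word_eval_word_eq [of w v] by (simp add: word_class_def)
  ultimately have "word_eval G h ` word_class S R w = {word_eval G h w}"
    by blast
  then show ?thesis by (simp add: presented_lift_def)
qed

lemma presented_lift_hom: "presented_lift G h \<in> hom (presented_group S R) G"
proof (rule homI)
  fix X assume "X \<in> carrier (presented_group S R)"
  then show "presented_lift G h X \<in> carrier G"
    by (auto simp: presented_group_def presented_lift_class word_eval_closed)
next
  fix X Y assume "X \<in> carrier (presented_group S R)" "Y \<in> carrier (presented_group S R)"
  then obtain u v where "u \<in> words S" "X = word_class S R u"
      "v \<in> words S" "Y = word_class S R v"
    by (auto simp: presented_group_def)
  then show "presented_lift G h (X \<otimes>\<^bsub>presented_group S R\<^esub> Y) =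
      presented_lift G h X \<otimes> presented_lift G h Y"
    by (simp add: presented_mult presented_lift_class word_eval_append)
qed

lemma presented_lift_generator:
  "x \<in> S \<Longrightarrow> presented_lift G h (word_class S R [(x, True)]) = h x"
  by (simp add: presented_lift_class h_closed)

end


section \<open>The adjoint group and the fundamental group\<close>

definition adj_relations :: "('a, 'm) quandle_scheme \<Rightarrow> ('a group_word \<times> 'a group_word) set"
  where "adj_relations Q = {([(a \<star>\<^bsub>Q\<^esub> b, True)], [(b, False), (a, True), (b, True)]) | a b.
    a \<in> carrier Q \<and> b \<in> carrier Q}"

definition Adj :: "('a, 'm) quandle_scheme \<Rightarrow> 'a group_word set monoid"
  where "Adj Q = presented_group (carrier Q) (adj_relations Q)"

definition adj :: "('a, 'm) quandle_scheme \<Rightarrow> 'a \<Rightarrow> 'a group_word set"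
  where "adj Q a = word_class (carrier Q) (adj_relations Q) [(a, True)]"

text \<open>\<open>Adj(f)\<close> sends \<open>adj(a)\<close> to \<open>adj(f(a))\<close>; the source enters only through the words it is applied to.\<close>

definition Adj_map :: "('b, 'n) quandle_scheme \<Rightarrow> ('a \<Rightarrow> 'b) \<Rightarrow> 'a group_word set \<Rightarrow> 'b group_word set"
  where "Adj_map Q' f = presented_lift (Adj Q') (\<lambda>a. adj Q' (f a))"

definition Adj_eps :: "'a group_word set \<Rightarrow> int"
  where "Adj_eps = presented_lift integer_group (\<lambda>a. 1)"

primrec letter_act :: "('a, 'm) quandle_scheme \<Rightarrow> 'a \<Rightarrow> 'a \<times> bool \<Rightarrow> 'a"
  where "letter_act Q a (b, e) = (if e then a \<star>\<^bsub>Q\<^esub> b else a \<diamondop>\<^bsub>Q\<^esub> b)"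

text \<open>
  \<open>Adj_act Q a g\<close> is \<open>a\<^sup>g\<close>. The letters of a word act from left to right, as befits a
  right action.
\<close>

definition Adj_act :: "('a, 'm) quandle_scheme \<Rightarrow> 'a \<Rightarrow> 'a group_word set \<Rightarrow> 'a"
  where "Adj_act Q a g = the_elem (foldl (letter_act Q) a ` g)"

definition Adj_zero :: "('a, 'm) quandle_scheme \<Rightarrow> 'a group_word set set"
  where "Adj_zero Q = kernel (Adj Q) integer_group Adj_eps"

definition pi1 :: "'a pointed_quandle \<Rightarrow> 'a group_word set monoid"
  where "pi1 Q = (Adj Q)\<lparr>carrier := {g \<in> Adj_zero Q. Adj_act Q (base Q) g = base Q}\<rparr>"

definition pi1_map :: "'a pointed_quandle \<Rightarrow> 'b pointed_quandle \<Rightarrow> ('a \<Rightarrow> 'b) \<Rightarrow>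
    'a group_word set \<Rightarrow> 'b group_word set"
  where "pi1_map Q Q' f = restrict (Adj_map Q' f) (carrier (pi1 Q))"

lemma group_Adj: "group (Adj Q)"
  by (simp add: Adj_def group_presented_group)

lemma adj_closed: "a \<in> carrier Q \<Longrightarrow> adj Q a \<in> carrier (Adj Q)"
  by (simp add: Adj_def adj_def presented_group_def)

lemma presentation_map_AdjI:
  assumes "group G" and h: "\<And>a. a \<in> carrier Q \<Longrightarrow> h a \<in> carrier G"
    and r: "\<And>a b. \<lbrakk>a \<in> carrier Q; b \<in> carrier Q\<rbrakk>
      \<Longrightarrow> h (a \<star>\<^bsub>Q\<^esub> b) = inv\<^bsub>G\<^esub> h b \<otimes>\<^bsub>G\<^esub> h a \<otimes>\<^bsub>G\<^esub> h b"
  shows "presentation_map G (carrier Q) (adj_relations Q) h"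
proof -
  interpret group G by fact
  show ?thesis
  proof
    fix u v assume "(u, v) \<in> adj_relations Q" "u \<in> words (carrier Q)" "v \<in> words (carrier Q)"
    then obtain a b where *: "a \<in> carrier Q" "b \<in> carrier Q" "a \<star>\<^bsub>Q\<^esub> b \<in> carrier Q"
      and "u = [(a \<star>\<^bsub>Q\<^esub> b, True)]" "v = [(b, False), (a, True), (b, True)]"
      by (auto simp: adj_relations_def)
    then show "word_eval G h u = word_eval G h v"
      using r [OF *(1,2)] h [OF *(1)] h [OF *(2)] h [OF *(3)] by (simp add: m_assoc)
  qed (rule h)
qed

context quandle
begin

lemma adj_inv_eq:
  assumes "b \<in> carrier Q"
  shows "inv\<^bsub>Adj Q\<^esub> adj Q b = word_class (carrier Q) (adj_relations Q) [(b, False)]"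
proof -
  interpret A: group "Adj Q" by (rule group_Adj)
  let ?c = "word_class (carrier Q) (adj_relations Q)"
  have "?c [(b, False)] \<otimes>\<^bsub>Adj Q\<^esub> adj Q b = ?c ([(b, False)] @ [(b, True)])"
    unfolding Adj_def adj_def using assms by (intro presented_mult) auto
  also have "\<dots> = ?c []"
    using word_eq.cancel [OF assms, of _ False] by (intro word_class_eqI) simp
  finally have "?c [(b, False)] \<otimes>\<^bsub>Adj Q\<^esub> adj Q b = \<one>\<^bsub>Adj Q\<^esub>"
    by (simp add: Adj_def presented_group_def)
  moreover have "?c [(b, False)] \<in> carrier (Adj Q)"
    using assms by (simp add: Adj_def presented_group_def)
  ultimately show ?thesis
    using assms by (simp add: A.inv_equality adj_closed)
qed

lemma adj_qop:
  assumes "a \<in> carrier Q" "b \<in> carrier Q"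
  shows "adj Q (a \<star> b) = inv\<^bsub>Adj Q\<^esub> adj Q b \<otimes>\<^bsub>Adj Q\<^esub> adj Q a \<otimes>\<^bsub>Adj Q\<^esub> adj Q b"
proof -
  have "inv\<^bsub>Adj Q\<^esub> adj Q b \<otimes>\<^bsub>Adj Q\<^esub> adj Q a \<otimes>\<^bsub>Adj Q\<^esub> adj Q b =
      word_class (carrier Q) (adj_relations Q) [(b, False), (a, True), (b, True)]"
    unfolding adj_inv_eq [OF assms(2)] using assms by (simp add: Adj_def adj_def presented_mult)
  also have "\<dots> = adj Q (a \<star> b)"
    unfolding adj_def using assms
    by (intro word_class_eqI word_eq.sym [OF word_eq.rel]) (auto simp: adj_relations_def)
  finally show ?thesis ..
qed

lemma presentation_map_eps:
  "presentation_map integer_group (carrier Q) (adj_relations Q) (\<lambda>a. 1)"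
  by (rule presentation_map_AdjI) auto

lemma Adj_eps_hom: "Adj_eps \<in> hom (Adj Q) integer_group"
  unfolding Adj_eps_def Adj_def
  by (rule presentation_map.presented_lift_hom [OF presentation_map_eps])

lemma Adj_eps_adj: "a \<in> carrier Q \<Longrightarrow> Adj_eps (adj Q a) = 1"
  unfolding Adj_eps_def adj_def
  by (rule presentation_map.presented_lift_generator [OF presentation_map_eps])

lemma presentation_map_Adj_map:
  assumes "quandle Q'" "f \<in> quandle_hom Q Q'"
  shows "presentation_map (Adj Q') (carrier Q) (adj_relations Q) (\<lambda>a. adj Q' (f a))"
  using assms
  by (intro presentation_map_AdjI group_Adj)
     (auto simp: quandle_hom_def adj_closed Pi_iff quandle.adj_qop)

lemma Adj_map_hom:
  "\<lbrakk>quandle Q'; f \<in> quandle_hom Q Q'\<rbrakk> \<Longrightarrow> Adj_map Q' f \<in> hom (Adj Q) (Adj Q')"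
  unfolding Adj_map_def Adj_def [of Q]
  by (rule presentation_map.presented_lift_hom [OF presentation_map_Adj_map])

lemma Adj_map_adj:
  "\<lbrakk>quandle Q'; f \<in> quandle_hom Q Q'; a \<in> carrier Q\<rbrakk> \<Longrightarrow> Adj_map Q' f (adj Q a) = adj Q' (f a)"
  unfolding Adj_map_def adj_def [of Q]
  by (rule presentation_map.presented_lift_generator [OF presentation_map_Adj_map])

lemma letter_act_closed:
  "\<lbrakk>a \<in> carrier Q; fst l \<in> carrier Q\<rbrakk> \<Longrightarrow> letter_act Q a l \<in> carrier Q"
  by (cases l) simp

lemma foldl_act_closed:
  "\<lbrakk>a \<in> carrier Q; w \<in> words (carrier Q)\<rbrakk> \<Longrightarrow> foldl (letter_act Q) a w \<in> carrier Q"
  by (induction w arbitrary: a) (simp_all add: letter_act_closed)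

lemma foldl_act_word_eq:
  "\<lbrakk>word_eq (carrier Q) (adj_relations Q) u v; a \<in> carrier Q\<rbrakk>
    \<Longrightarrow> foldl (letter_act Q) a u = foldl (letter_act Q) a v"
proof (induction arbitrary: a rule: word_eq.induct)
  case (append u u' v v')
  then show ?case
    using word_eq_words [OF append.hyps(1)] by (simp add: foldl_act_closed)
next
  case (cancel x e)
  then show ?case by (cases e) (auto simp: qop_qbar qbar_qop)
next
  case (rel u v)
  then show ?case
    using qop_distrib qbar_qop by (auto simp: adj_relations_def)
qed auto

lemma Adj_act_class:
  assumes "a \<in> carrier Q" "w \<in> words (carrier Q)"
  shows "Adj_act Q a (word_class (carrier Q) (adj_relations Q) w) = foldl (letter_act Q) a w"
proof -
  let ?W = "word_class (carrier Q) (adj_relations Q) w"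
  have "w \<in> ?W"
    using assms by (simp add: word_class_def word_eq.refl)
  moreover have "foldl (letter_act Q) a v = foldl (letter_act Q) a w" if "v \<in> ?W" for v
    using that foldl_act_word_eq [of w v a] assms(1) by (simp add: word_class_def)
  ultimately have "foldl (letter_act Q) a ` ?W = {foldl (letter_act Q) a w}"
    by blast
  then show ?thesis by (simp add: Adj_act_def)
qed

lemma Adj_act_closed:
  "\<lbrakk>a \<in> carrier Q; g \<in> carrier (Adj Q)\<rbrakk> \<Longrightarrow> Adj_act Q a g \<in> carrier Q"
  by (auto simp: Adj_def presented_group_def Adj_act_class foldl_act_closed)

lemma Adj_act_adj: "\<lbrakk>a \<in> carrier Q; b \<in> carrier Q\<rbrakk> \<Longrightarrow> Adj_act Q a (adj Q b) = a \<star> b"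
  unfolding adj_def by (subst Adj_act_class) auto

lemma Adj_act_one: "a \<in> carrier Q \<Longrightarrow> Adj_act Q a \<one>\<^bsub>Adj Q\<^esub> = a"
  unfolding Adj_def presented_group_def by (simp add: Adj_act_class)

lemma Adj_act_mult:
  assumes "a \<in> carrier Q" "g \<in> carrier (Adj Q)" "h \<in> carrier (Adj Q)"
  shows "Adj_act Q a (g \<otimes>\<^bsub>Adj Q\<^esub> h) = Adj_act Q (Adj_act Q a g) h"
proof -
  obtain u v where "u \<in> words (carrier Q)" "g = word_class (carrier Q) (adj_relations Q) u"
      "v \<in> words (carrier Q)" "h = word_class (carrier Q) (adj_relations Q) v"
    using assms by (auto simp: Adj_def presented_group_def)
  then show ?thesis
    using assms(1) by (simp add: Adj_def presented_mult Adj_act_class foldl_act_closed)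
qed

end


section \<open>Categories and functors\<close>

text \<open>Composition is written in applicative order: \<open>comp X Y Z g f\<close> is \<open>g \<circ> f : X \<rightarrow> Z\<close>.\<close>

record ('o, 'm) category =
  objs :: "'o set"
  mor :: "'o \<Rightarrow> 'o \<Rightarrow> 'm set"
  ident :: "'o \<Rightarrow> 'm"
  comp :: "'o \<Rightarrow> 'o \<Rightarrow> 'o \<Rightarrow> 'm \<Rightarrow> 'm \<Rightarrow> 'm"

locale category =
  fixes C :: "('o, 'm) category"
  assumes ident_mor: "X \<in> objs C \<Longrightarrow> ident C X \<in> mor C X X"
    and comp_mor: "\<lbrakk>X \<in> objs C; Y \<in> objs C; Z \<in> objs C; f \<in> mor C X Y; g \<in> mor C Y Z\<rbrakk>
      \<Longrightarrow> comp C X Y Z g f \<in> mor C X Z"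
    and comp_ident_left: "\<lbrakk>X \<in> objs C; Y \<in> objs C; f \<in> mor C X Y\<rbrakk>
      \<Longrightarrow> comp C X Y Y (ident C Y) f = f"
    and comp_ident_right: "\<lbrakk>X \<in> objs C; Y \<in> objs C; f \<in> mor C X Y\<rbrakk>
      \<Longrightarrow> comp C X X Y f (ident C X) = f"
    and comp_assoc: "\<lbrakk>W \<in> objs C; X \<in> objs C; Y \<in> objs C; Z \<in> objs C;
        f \<in> mor C W X; g \<in> mor C X Y; h \<in> mor C Y Z\<rbrakk>
      \<Longrightarrow> comp C W Y Z h (comp C W X Y g f) = comp C W X Z (comp C X Y Z h g) f"

locale category_functor = C: category C + D: category D
  for C :: "('o, 'm) category" and D :: "('p, 'n) category"
    and F :: "'o \<Rightarrow> 'p" and F_map :: "'o \<Rightarrow> 'o \<Rightarrow> 'm \<Rightarrow> 'n" +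
  assumes F_obj: "X \<in> objs C \<Longrightarrow> F X \<in> objs D"
    and F_mor: "\<lbrakk>X \<in> objs C; Y \<in> objs C; f \<in> mor C X Y\<rbrakk> \<Longrightarrow> F_map X Y f \<in> mor D (F X) (F Y)"
    and F_ident: "X \<in> objs C \<Longrightarrow> F_map X X (ident C X) = ident D (F X)"
    and F_comp: "\<lbrakk>X \<in> objs C; Y \<in> objs C; Z \<in> objs C; f \<in> mor C X Y; g \<in> mor C Y Z\<rbrakk>
      \<Longrightarrow> F_map X Z (comp C X Y Z g f) = comp D (F X) (F Y) (F Z) (F_map Y Z g) (F_map X Y f)"

text \<open>
  A type variable serves as the universe: the objects are the structures whose carrier is
  a subset of that type. Morphisms are maps of carriers, so they are taken extensional, with
  the dummy value \<open>undefined\<close> off the carrier of the source.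
\<close>

definition pointed_quandle_cat :: "('a pointed_quandle, 'a \<Rightarrow> 'a) category"
  where "pointed_quandle_cat =
    \<lparr>objs = {Q. pointed_quandle Q},
     mor = (\<lambda>Q Q'. pointed_quandle_hom Q Q' \<inter> extensional (carrier Q)),
     ident = (\<lambda>Q. \<lambda>a\<in>carrier Q. a),
     comp = (\<lambda>Q Q' Q'' g f. compose (carrier Q) g f)\<rparr>"

definition group_cat :: "('g monoid, 'g \<Rightarrow> 'g) category"
  where "group_cat =
    \<lparr>objs = {G. group G},
     mor = (\<lambda>G H. hom G H \<inter> extensional (carrier G)),
     ident = (\<lambda>G. \<lambda>x\<in>carrier G. x),
     comp = (\<lambda>G H K g f. compose (carrier G) g f)\<rparr>"

end

theory Submission
  imports Defs
begin

text \<open>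
  Every element of the adjoint group is the class of a word in the elements of the quandle, and
  on such classes the induced homomorphism renames letters: the class of \<open>w\<close> goes to the class of
  \<open>map (apfst f) w\<close> (lemma \<open>Adj_map_class\<close>). Once this is known, functoriality of the adjoint
  group is functoriality of \<open>map\<close> on lists.

  It remains to see that renaming letters carries \<open>\<pi>\<^sub>1(Q, q)\<close> into \<open>\<pi>\<^sub>1(Q', q')\<close>. The
  homomorphism \<open>\<epsilon>\<close> only sees the exponents of the letters, which a renaming leaves alone. The action
  is equivariant, \<open>f(a)\<^sup>h = f(a\<^sup>g)\<close> for \<open>h = Adj(f)(g)\<close>: on a single letter this
  says that \<open>f\<close> preserves both quandle operations, and the second one is
  preserved because right multiplication by \<open>f(b)\<close> is injective. So an element \<open>g\<close> fixing \<open>q\<close> is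
  sent to one fixing \<open>f(q) = q'\<close>. Finally \<open>\<pi>\<^sub>1(Q, q)\<close> is a subgroup of the adjoint group,
  being the intersection of the kernel of \<open>\<epsilon>\<close> with the stabiliser of \<open>q\<close>.
\<close>

section \<open>Quandle homomorphisms\<close>

lemma quandle_hom_closed: "\<lbrakk>f \<in> quandle_hom Q Q'; a \<in> carrier Q\<rbrakk> \<Longrightarrow> f a \<in> carrier Q'"
  by (auto simp: quandle_hom_def)

lemma quandle_hom_qop:
  "\<lbrakk>f \<in> quandle_hom Q Q'; a \<in> carrier Q; b \<in> carrier Q\<rbrakk>
    \<Longrightarrow> f (a \<star>\<^bsub>Q\<^esub> b) = f a \<star>\<^bsub>Q'\<^esub> f b"
  by (auto simp: quandle_hom_def)

text \<open>
  A homomorphism is only required to preserve the first operation; the second is its inverse: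
  both sides of the equation give \<open>f a\<close> when multiplied by \<open>f b\<close> on the right.
\<close>

lemma quandle_hom_qbar:
  assumes "quandle Q" "quandle Q'" and f: "f \<in> quandle_hom Q Q'"
    and ab: "a \<in> carrier Q" "b \<in> carrier Q"
  shows "f (a \<diamondop>\<^bsub>Q\<^esub> b) = f a \<diamondop>\<^bsub>Q'\<^esub> f b"
proof -
  interpret Q: quandle Q by fact
  interpret Q': quandle Q' by fact
  have "f (a \<diamondop>\<^bsub>Q\<^esub> b) \<star>\<^bsub>Q'\<^esub> f b = f a"
    using quandle_hom_qop [OF f, of "a \<diamondop>\<^bsub>Q\<^esub> b" b] ab by (simp add: Q.qbar_qop)
  then show ?thesis
    using Q'.qop_qbar [of "f (a \<diamondop>\<^bsub>Q\<^esub> b)" "f b"] ab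
    by (simp add: quandle_hom_closed [OF f])
qed

lemma pointed_quandle_hom_compose:
  assumes "pointed_quandle Q" "f \<in> pointed_quandle_hom Q Q'" "g \<in> pointed_quandle_hom Q' Q''"
  shows "compose (carrier Q) g f \<in> pointed_quandle_hom Q Q''"
proof -
  interpret pointed_quandle Q by fact
  show ?thesis
    using assms(2,3) by (auto simp: pointed_quandle_hom_def quandle_hom_def compose_eq Pi_iff)
qed


section \<open>The adjoint group as a functor\<close>

lemma carrier_Adj:
  "carrier (Adj Q) = word_class (carrier Q) (adj_relations Q) ` words (carrier Q)"
  by (simp add: Adj_def presented_group_def)

lemma words_map_apfst:
  "\<lbrakk>w \<in> words S; \<And>x. x \<in> S \<Longrightarrow> f x \<in> T\<rbrakk> \<Longrightarrow> map (apfst f) w \<in> words T"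
  by (induction w) auto

lemma word_eval_cong:
  "\<lbrakk>w \<in> words S; \<And>x. x \<in> S \<Longrightarrow> h x = h' x\<rbrakk> \<Longrightarrow> word_eval G h w = word_eval G h' w"
  by (induction w) auto

text \<open>
  Morphisms of pointed quandles are composed as extensional maps, so \<open>Adj(f)\<close> has to be insensitive
  to the values of \<open>f\<close> off the carrier. It is, since a class contains only words over the carrier.
\<close>

lemma Adj_map_cong:
  assumes "X \<in> carrier (Adj Q)" and f: "\<And>a. a \<in> carrier Q \<Longrightarrow> f a = f' a"
  shows "Adj_map Q' f X = Adj_map Q' f' X"
proof -
  have "v \<in> words (carrier Q)" if "v \<in> X" for v
    using assms(1) that by (auto simp: carrier_Adj word_class_def dest: word_eq_words)
  then have "word_eval (Adj Q') (\<lambda>a. adj Q' (f a)) ` X = word_eval (Adj Q') (\<lambda>a. adj Q' (f' a)) ` X"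
    by (intro image_cong refl word_eval_cong) (auto simp: f)
  then show ?thesis
    by (simp add: Adj_map_def presented_lift_def)
qed

text \<open>
  Evaluating a word in the adjoint group multiplies the classes of its letters one at a time;
  since multiplication of classes is concatenation, the letters reassemble into a single word.
  This identifies \<open>Adj(f)\<close>, defined through evaluation, with the renaming of letters.
\<close>

lemma (in quandle) word_eval_adj:
  assumes "w \<in> words S" and f: "\<And>x. x \<in> S \<Longrightarrow> f x \<in> carrier Q"
  shows "word_eval (Adj Q) (\<lambda>a. adj Q (f a)) w =
    word_class (carrier Q) (adj_relations Q) (map (apfst f) w)"
  using assms(1)
proof (induction w)
  case Nil
  show ?case by (simp add: Adj_def presented_group_def)
next
  case (Cons l w)
  obtain x e where l: "l = (x, e)" by force
  let ?c = "word_class (carrier Q) (adj_relations Q)"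
  have x: "f x \<in> carrier Q" and w: "map (apfst f) w \<in> words (carrier Q)"
    using Cons.prems f by (auto simp: l intro: words_map_apfst)
  have "(if e then adj Q (f x) else inv\<^bsub>Adj Q\<^esub> adj Q (f x)) = ?c [(f x, e)]"
    using adj_inv_eq [OF x] by (cases e) (simp_all add: adj_def)
  moreover have "?c [(f x, e)] \<otimes>\<^bsub>Adj Q\<^esub> ?c (map (apfst f) w) =
      ?c ([(f x, e)] @ map (apfst f) w)"
    unfolding Adj_def using x w by (intro presented_mult) auto
  ultimately show ?case
    using Cons by (cases e) (simp_all add: l)
qed

lemma Adj_map_class:
  assumes "quandle Q" "quandle Q'" and f: "f \<in> quandle_hom Q Q'" and w: "w \<in> words (carrier Q)"
  shows "Adj_map Q' f (word_class (carrier Q) (adj_relations Q) w) =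
    word_class (carrier Q') (adj_relations Q') (map (apfst f) w)"
proof -
  interpret presentation_map "Adj Q'" "carrier Q" "adj_relations Q" "\<lambda>a. adj Q' (f a)"
    by (rule quandle.presentation_map_Adj_map) fact+
  show ?thesis
    unfolding Adj_map_def presented_lift_class [OF w]
    by (rule quandle.word_eval_adj [OF \<open>quandle Q'\<close> w quandle_hom_closed [OF f]])
qed

lemma Adj_map_id:
  fixes Q :: "('a, 'm) quandle_scheme"
  assumes "quandle Q" "X \<in> carrier (Adj Q)"
  shows "Adj_map Q (\<lambda>a. a) X = X"
proof -
  have "(\<lambda>a. a) \<in> quandle_hom Q Q"
    by (simp add: quandle_hom_def)
  moreover have "map (apfst (\<lambda>a. a)) w = w" for w :: "'a group_word"
    by (induction w) auto
  ultimately show ?thesis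
    using assms by (auto simp: carrier_Adj Adj_map_class)
qed

lemma Adj_map_comp:
  assumes "quandle Q" "quandle Q'" "quandle Q''"
    and f: "f \<in> quandle_hom Q Q'" and g: "g \<in> quandle_hom Q' Q''" and X: "X \<in> carrier (Adj Q)"
  shows "Adj_map Q'' (g \<circ> f) X = Adj_map Q'' g (Adj_map Q' f X)"
proof -
  have gf: "g \<circ> f \<in> quandle_hom Q Q''"
    using f g by (auto simp: quandle_hom_def Pi_iff)
  obtain w where w: "w \<in> words (carrier Q)" "X = word_class (carrier Q) (adj_relations Q) w"
    using X by (auto simp: carrier_Adj)
  have "map (apfst f) w \<in> words (carrier Q')"
    using w(1) quandle_hom_closed [OF f] by (rule words_map_apfst)
  moreover have "map (apfst (g \<circ> f)) w = map (apfst g) (map (apfst f) w)"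
    by (induction w) auto
  ultimately show ?thesis
    using assms w by (simp add: Adj_map_class gf del: map_map)
qed


section \<open>Compatibility with the degree and with the action\<close>

lemma (in quandle) Adj_eps_class:
  "w \<in> words (carrier Q) \<Longrightarrow>
    Adj_eps (word_class (carrier Q) (adj_relations Q) w) = word_eval integer_group (\<lambda>a. 1) w"
  unfolding Adj_eps_def by (rule presentation_map.presented_lift_class [OF presentation_map_eps])

lemma Adj_eps_Adj_map:
  assumes "quandle Q" "quandle Q'" and f: "f \<in> quandle_hom Q Q'" and X: "X \<in> carrier (Adj Q)"
  shows "Adj_eps (Adj_map Q' f X) = Adj_eps X"
proof -
  obtain w where w: "w \<in> words (carrier Q)" "X = word_class (carrier Q) (adj_relations Q) w"
    using X by (auto simp: carrier_Adj)
  have fw: "map (apfst f) w \<in> words (carrier Q')"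
    using w(1) quandle_hom_closed [OF f] by (rule words_map_apfst)
  have "word_eval integer_group (\<lambda>a. 1) (map (apfst f) w) = word_eval integer_group (\<lambda>a. 1) w"
    by (induction w) auto
  then show ?thesis
    using assms w fw by (simp add: Adj_map_class quandle.Adj_eps_class)
qed

text \<open>
  Equivariance is proved on words, where a letter may act by either operation; hence
  the need for \<open>quandle_hom_qbar\<close>.
\<close>

lemma foldl_letter_act_hom:
  assumes "quandle Q" "quandle Q'" and f: "f \<in> quandle_hom Q Q'"
    and "a \<in> carrier Q" "w \<in> words (carrier Q)"
  shows "foldl (letter_act Q') (f a) (map (apfst f) w) = f (foldl (letter_act Q) a w)"
  using assms(4,5)
proof (induction w arbitrary: a)
  case (Cons l w)
  obtain x e where l: "l = (x, e)" by force
  have "letter_act Q' (f a) (apfst f l) = f (letter_act Q a l)"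
    using Cons.prems assms
    by (simp add: l quandle_hom_qop [OF f] quandle_hom_qbar [OF assms(1-3)])
  moreover have "letter_act Q a l \<in> carrier Q"
    using Cons.prems assms(1) by (simp add: quandle.letter_act_closed)
  ultimately show ?case
    using Cons by simp
qed simp

lemma Adj_act_Adj_map:
  assumes "quandle Q" "quandle Q'" and f: "f \<in> quandle_hom Q Q'"
    and a: "a \<in> carrier Q" and X: "X \<in> carrier (Adj Q)"
  shows "Adj_act Q' (f a) (Adj_map Q' f X) = f (Adj_act Q a X)"
proof -
  obtain w where w: "w \<in> words (carrier Q)" "X = word_class (carrier Q) (adj_relations Q) w"
    using X by (auto simp: carrier_Adj)
  have "map (apfst f) w \<in> words (carrier Q')"
    using w(1) quandle_hom_closed [OF f] by (rule words_map_apfst)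
  then show ?thesis
    using assms w
    by (simp add: Adj_map_class quandle.Adj_act_class quandle_hom_closed foldl_letter_act_hom)
qed


section \<open>The fundamental group as a functor\<close>

lemma carrier_pi1:
  "carrier (pi1 Q) = {X \<in> carrier (Adj Q). Adj_eps X = 0 \<and> Adj_act Q (base Q) X = base Q}"
  by (auto simp: pi1_def Adj_zero_def kernel_def)

lemma mult_pi1: "X \<otimes>\<^bsub>pi1 Q\<^esub> Y = X \<otimes>\<^bsub>Adj Q\<^esub> Y"
  by (simp add: pi1_def)

text \<open>
  The kernel of \<open>\<epsilon>\<close> is a subgroup because \<open>\<epsilon>\<close> is a homomorphism, and the elements fixing \<open>q\<close> form
  one because the adjoint group acts: if \<open>q = q\<^sup>g\<close>, apply the inverse of \<open>g\<close> to both sides.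
\<close>

lemma subgroup_pi1:
  assumes "pointed_quandle Q"
  shows "subgroup (carrier (pi1 Q)) (Adj Q)"
proof -
  interpret pointed_quandle Q by fact
  interpret A: group "Adj Q" by (rule group_Adj)
  interpret eps: group_hom "Adj Q" integer_group Adj_eps
    by (intro group_hom.intro group_hom_axioms.intro A.is_group group_integer_group Adj_eps_hom)
  show ?thesis
  proof (rule A.subgroupI)
    have "\<one>\<^bsub>Adj Q\<^esub> \<in> carrier (pi1 Q)"
      using eps.hom_one by (simp add: carrier_pi1 Adj_act_one)
    then show "carrier (pi1 Q) \<noteq> {}" by blast
  next
    fix X assume X: "X \<in> carrier (pi1 Q)"
    have "Adj_act Q (base Q) (inv\<^bsub>Adj Q\<^esub> X) =
        Adj_act Q (Adj_act Q (base Q) X) (inv\<^bsub>Adj Q\<^esub> X)"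
      using X by (simp add: carrier_pi1)
    also have "\<dots> = Adj_act Q (base Q) (X \<otimes>\<^bsub>Adj Q\<^esub> inv\<^bsub>Adj Q\<^esub> X)"
      using X by (intro Adj_act_mult [symmetric]) (simp_all add: carrier_pi1)
    also have "\<dots> = base Q"
      using X by (simp add: carrier_pi1 Adj_act_one)
    finally show "inv\<^bsub>Adj Q\<^esub> X \<in> carrier (pi1 Q)"
      using X eps.hom_inv [of X] by (simp add: carrier_pi1)
  next
    fix X Y assume "X \<in> carrier (pi1 Q)" "Y \<in> carrier (pi1 Q)"
    then show "X \<otimes>\<^bsub>Adj Q\<^esub> Y \<in> carrier (pi1 Q)"
      using eps.hom_mult [of X Y] by (simp add: carrier_pi1 Adj_act_mult)
  qed (auto simp: carrier_pi1)
qed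

lemma group_pi1:
  assumes "pointed_quandle Q"
  shows "group (pi1 Q)"
proof -
  have "group (Adj Q \<lparr>carrier := carrier (pi1 Q)\<rparr>)"
    by (rule subgroup.subgroup_is_group [OF subgroup_pi1 [OF assms] group_Adj])
  then show ?thesis by (simp add: pi1_def)
qed

lemma Adj_map_pi1:
  assumes "pointed_quandle Q" "pointed_quandle Q'" "f \<in> pointed_quandle_hom Q Q'"
    and X: "X \<in> carrier (pi1 Q)"
  shows "Adj_map Q' f X \<in> carrier (pi1 Q')"
proof -
  interpret Q: pointed_quandle Q by fact
  interpret Q': pointed_quandle Q' by fact
  have f: "f \<in> quandle_hom Q Q'" "f (base Q) = base Q'"
    using assms(3) by (auto simp: pointed_quandle_hom_def)
  note hom = Q.quandle_axioms Q'.quandle_axioms f(1)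
  have X': "X \<in> carrier (Adj Q)" "Adj_eps X = 0" "Adj_act Q (base Q) X = base Q"
    using X by (auto simp: carrier_pi1)
  have "Adj_map Q' f X \<in> carrier (Adj Q')"
    using Q.Adj_map_hom [OF hom(2,3)] X'(1) by (rule hom_in_carrier)
  moreover have "Adj_eps (Adj_map Q' f X) = 0"
    using Adj_eps_Adj_map [OF hom X'(1)] X'(2) by simp
  moreover have "Adj_act Q' (base Q') (Adj_map Q' f X) = base Q'"
    using Adj_act_Adj_map [OF hom Q.base_closed X'(1)] X'(3) f(2) by simp
  ultimately show ?thesis by (simp add: carrier_pi1)
qed

lemma pi1_map_hom:
  assumes "pointed_quandle Q" "pointed_quandle Q'" "f \<in> pointed_quandle_hom Q Q'"
  shows "pi1_map Q Q' f \<in> hom (pi1 Q) (pi1 Q')"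
proof -
  interpret Q: pointed_quandle Q by fact
  interpret Q': pointed_quandle Q' by fact
  interpret P: group "pi1 Q" by (rule group_pi1) fact
  have "f \<in> quandle_hom Q Q'"
    using assms(3) by (simp add: pointed_quandle_hom_def)
  then have "Adj_map Q' f \<in> hom (Adj Q) (Adj Q')"
    by (rule Q.Adj_map_hom [OF Q'.quandle_axioms])
  then have "Adj_map Q' f (X \<otimes>\<^bsub>pi1 Q\<^esub> Y) = Adj_map Q' f X \<otimes>\<^bsub>pi1 Q'\<^esub> Adj_map Q' f Y"
    if "X \<in> carrier (pi1 Q)" "Y \<in> carrier (pi1 Q)" for X Y
    using that by (simp add: mult_pi1 hom_mult carrier_pi1)
  then show ?thesis
    by (intro homI) (simp_all add: pi1_map_def Adj_map_pi1 [OF assms])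
qed

lemma pi1_map_cong:
  "(\<And>a. a \<in> carrier Q \<Longrightarrow> f a = f' a) \<Longrightarrow> pi1_map Q Q' f = pi1_map Q Q' f'"
  unfolding pi1_map_def by (intro restrict_ext Adj_map_cong) (auto simp: carrier_pi1)

lemma pi1_map_id: "quandle Q \<Longrightarrow> pi1_map Q Q (\<lambda>a. a) = (\<lambda>X\<in>carrier (pi1 Q). X)"
  unfolding pi1_map_def by (intro restrict_ext Adj_map_id) (auto simp: carrier_pi1)

lemma pi1_map_comp:
  assumes "pointed_quandle Q" "pointed_quandle Q'" "pointed_quandle Q''"
    and f: "f \<in> pointed_quandle_hom Q Q'" and g: "g \<in> pointed_quandle_hom Q' Q''"
  shows "pi1_map Q Q'' (g \<circ> f) = compose (carrier (pi1 Q)) (pi1_map Q' Q'' g) (pi1_map Q Q' f)"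
proof -
  have "Adj_map Q'' (g \<circ> f) X = pi1_map Q' Q'' g (pi1_map Q Q' f X)"
    if X: "X \<in> carrier (pi1 Q)" for X
  proof -
    have "Adj_map Q'' (g \<circ> f) X = Adj_map Q'' g (Adj_map Q' f X)"
      using assms X
      by (intro Adj_map_comp) (auto simp: pointed_quandle_def pointed_quandle_hom_def carrier_pi1)
    then show ?thesis
      using X Adj_map_pi1 [OF assms(1,2) f X] by (simp add: pi1_map_def)
  qed
  then show ?thesis
    unfolding pi1_map_def [of Q Q''] compose_def by (rule restrict_ext)
qed

lemma category_pointed_quandle_cat: "category pointed_quandle_cat"
proof
  fix Q :: "'a pointed_quandle"
  assume "Q \<in> objs pointed_quandle_cat"
  then interpret pointed_quandle Q by (simp add: pointed_quandle_cat_def)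
  show "ident pointed_quandle_cat Q \<in> mor pointed_quandle_cat Q Q"
    by (simp add: pointed_quandle_cat_def pointed_quandle_hom_def quandle_hom_def)
next
  fix Q Q' Q'' :: "'a pointed_quandle" and f g
  assume "Q \<in> objs pointed_quandle_cat"
    "f \<in> mor pointed_quandle_cat Q Q'" "g \<in> mor pointed_quandle_cat Q' Q''"
  then show "comp pointed_quandle_cat Q Q' Q'' g f \<in> mor pointed_quandle_cat Q Q''"
    by (auto simp: pointed_quandle_cat_def pointed_quandle_hom_compose)
qed (auto simp: pointed_quandle_cat_def pointed_quandle_hom_def quandle_hom_def
       compose_Id Id_compose intro!: compose_assoc)

lemma category_group_cat: "category group_cat"
  by unfold_locales
     (auto simp: group_cat_def hom_compose hom_def group.is_monoid
       compose_Id Id_compose compose_eq monoid.m_closed Pi_iff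
       intro!: compose_assoc)

lemma category_functor_pi1: "category_functor pointed_quandle_cat group_cat pi1 pi1_map"
proof (rule category_functor.intro [OF category_pointed_quandle_cat category_group_cat], unfold_locales)
  fix Q :: "'a pointed_quandle"
  assume "Q \<in> objs pointed_quandle_cat"
  then interpret pointed_quandle Q by (simp add: pointed_quandle_cat_def)
  show "pi1 Q \<in> objs group_cat"
    by (simp add: group_cat_def group_pi1 pointed_quandle_axioms)
  \<comment> \<open>The identity of the category is the identity map only on the carrier.\<close>
  have "pi1_map Q Q (\<lambda>a\<in>carrier Q. a) = pi1_map Q Q (\<lambda>a. a)"
    by (rule pi1_map_cong) simp
  then show "pi1_map Q Q (ident pointed_quandle_cat Q) = ident group_cat (pi1 Q)"
    by (simp add: pointed_quandle_cat_def group_cat_def pi1_map_id quandle_axioms)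
next
  fix Q Q' :: "'a pointed_quandle" and f
  assume "Q \<in> objs pointed_quandle_cat" "Q' \<in> objs pointed_quandle_cat"
    "f \<in> mor pointed_quandle_cat Q Q'"
  then show "pi1_map Q Q' f \<in> mor group_cat (pi1 Q) (pi1 Q')"
    by (auto simp: pointed_quandle_cat_def group_cat_def pi1_map_hom)
       (simp add: pi1_map_def)
next
  fix Q Q' Q'' :: "'a pointed_quandle" and f g
  assume *: "Q \<in> objs pointed_quandle_cat" "Q' \<in> objs pointed_quandle_cat"
    "Q'' \<in> objs pointed_quandle_cat"
    "f \<in> mor pointed_quandle_cat Q Q'" "g \<in> mor pointed_quandle_cat Q' Q''"
  have "pi1_map Q Q'' (compose (carrier Q) g f) = pi1_map Q Q'' (g \<circ> f)"
    by (rule pi1_map_cong) (simp add: compose_eq)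
  then show "pi1_map Q Q'' (comp pointed_quandle_cat Q Q' Q'' g f) =
      comp group_cat (pi1 Q) (pi1 Q') (pi1 Q'') (pi1_map Q' Q'' g) (pi1_map Q Q' f)"
    using * by (simp add: pointed_quandle_cat_def group_cat_def pi1_map_comp)
qed

theorem proposition1p8:
  shows
    "(\<forall>(Q :: 'a pointed_quandle) (Q' :: 'b pointed_quandle) f.
        pointed_quandle Q \<and> pointed_quandle Q' \<and> f \<in> pointed_quandle_hom Q Q' \<longrightarrow>
          group (pi1 Q) \<and> group (pi1 Q') \<and>
          Adj_map Q' f ` carrier (pi1 Q) \<subseteq> carrier (pi1 Q') \<and>
          pi1_map Q Q' f \<in> hom (pi1 Q) (pi1 Q')) \<and>
     (\<forall>(Q :: 'a pointed_quandle) (Q' :: 'b pointed_quandle) (Q'' :: 'c pointed_quandle) f g.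
        pointed_quandle Q \<and> pointed_quandle Q' \<and> pointed_quandle Q'' \<and>
        f \<in> pointed_quandle_hom Q Q' \<and> g \<in> pointed_quandle_hom Q' Q'' \<longrightarrow>
          pi1_map Q Q'' (g \<circ> f) = compose (carrier (pi1 Q)) (pi1_map Q' Q'' g) (pi1_map Q Q' f)) \<and>
     category_functor
       (pointed_quandle_cat :: ('u pointed_quandle, 'u \<Rightarrow> 'u) category)
       (group_cat :: ('u group_word set monoid, 'u group_word set \<Rightarrow> 'u group_word set) category)
       pi1 pi1_map"
  by (intro conjI allI impI category_functor_pi1)
     (auto simp: group_pi1 pi1_map_hom pi1_map_comp intro: Adj_map_pi1)

end
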